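(* Let $q$ be a prime power. For integers $1\le k\le n$, let $f_{k,n}$ be the number of $k\times n$ matrices $A$ over $\mathbf{F}_q$ of rank $k$ with $A_{ii}=0$ for all $1\le i\le k$. Then for $1\le k<n$, $$f_{k+1,n}=q^{k-1}(q-1)\bigl(f_{k,n}\cdot[n-k]_q-f_{k,n-1}\bigr),$$ with initial values $f_{1,n}=q^{n-1}-1$ for $n\ge1$.
   Context: $\mathbf{F}_q$ is the field with $q$ elements, and $[n]_q=\frac{q^n-1}{q-1}$. *)

theory Defs
  imports "Jordan_Normal_Form.DL_Rank" "HOL-Library.Cardinality" "HOL-Number_Theory.Prime_Powers"
begin

(* The argument is the ground field F_q, given as a type of class {field, finite}.
   vec_space.rank k A is the dimension of the column space of A inside the vectors of
   length k = dim_row A.  Entries $$ outside the index range are unspecified, so the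
   definition is only meaningful for k <= n. *)
definition zero_diag_full_rank_mats :: "'a::{field,finite} itself \<Rightarrow> nat \<Rightarrow> nat \<Rightarrow> 'a mat set" where
  "zero_diag_full_rank_mats F k n =
     {A \<in> carrier_mat k n. vec_space.rank k A = k \<and> (\<forall>i<k. A $$ (i, i) = 0)}"

definition num_zero_diag :: "'a::{field,finite} itself \<Rightarrow> nat \<Rightarrow> nat \<Rightarrow> nat" where
  "num_zero_diag F k n = card (zero_diag_full_rank_mats F k n)"

definition q_bracket :: "nat \<Rightarrow> nat \<Rightarrow> rat" where
  "q_bracket q n = (of_nat q ^ n - 1) / (of_nat q - 1)"

end

theory Submission
  imports Defs "Berlekamp_Zassenhaus.Berlekamp_Type_Based"
begin

text \<open>
  Build the matrices one row at a time. A matrix with k + 1 rows, zero diagonal and full row rank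
  consists of such a matrix A with k rows together with a vector v of length n that vanishes at
  position k (counted from 0) and lies outside the row space R of A
  (\<open>rank_append_row_iff\<close>). So the number of admissible v has to be found for each A.

  There are q ^ (n - 1) vectors vanishing at position k, and the ones inside R have to be
  subtracted. Since the rows of A are independent, R is parametrized bijectively by coefficient
  vectors c of length k, and the entry at position k of the combination with coefficients c is the
  scalar product of c with column k of A. Hence the forbidden vectors correspond to the solutions
  c of one linear equation: there are q ^ k of them if column k of A is zero, and q ^ (k - 1)
  otherwise (\<open>card_rows_outside\<close>, \<open>card_hyperplane\<close>).

  It remains to count the A whose column k is zero. Deleting that column changes neither the rank
  nor the first k diagonal entries, so there are as many of them as matrices of size k by n - 1
  (\<open>card_zero_diag_zero_col\<close>). Writing f k n for the number of matrices, the result is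
  f (k + 1) n = f k n * (q ^ (n - 1) - q ^ (k - 1)) - f k (n - 1) * (q ^ k - q ^ (k - 1)),
  and pulling out q ^ (k - 1) * (q - 1) gives the recurrence. The initial value is the same
  step applied to the unique matrix with no rows.
\<close>

section \<open>Full row rank in terms of the left kernel\<close>

text \<open>The vectors orthogonal to c form a subspace, which contains S and hence its span.\<close>

lemma (in vec_space) scalar_prod_span_zero:
  assumes S: "S \<subseteq> carrier_vec n" and c: "c \<in> carrier_vec n"
    and orth: "\<And>s. s \<in> S \<Longrightarrow> s \<bullet> c = 0" and v: "v \<in> span S"
  shows "v \<bullet> c = 0"
proof -
  have "submodule class_ring {v \<in> carrier_vec n. v \<bullet> c = 0} V"
    by (unfold_locales)
      (use c in \<open>auto simp: class_ring_simps module_vec_simps add_scalar_prod_distrib[where n = n]\<close>)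
  from span_is_subset[OF _ this, of S] S orth v show ?thesis by auto
qed

lemma (in vec_space) span_maximal_indpt_cols:
  assumes A: "A \<in> carrier_mat n nc"
    and max: "maximal S (\<lambda>T. T \<subseteq> set (cols A) \<and> lin_indpt T)"
  shows "set (cols A) \<subseteq> span S"
proof
  fix v assume v: "v \<in> set (cols A)"
  have cs: "set (cols A) \<subseteq> carrier_vec n" using A cols_dim by blast
  have S: "S \<subseteq> set (cols A)" "lin_indpt S" using max by (auto simp: maximal_def)
  hence Sc: "S \<subseteq> carrier_vec n" using cs by auto
  show "v \<in> span S"
  proof (rule ccontr)
    assume nv: "v \<notin> span S"
    hence vS: "v \<notin> S" using span_mem[OF Sc] by auto
    have "lin_indpt (S \<union> {v})"
      using lin_dep_iff_in_span[OF Sc S(2) _ vS] nv v cs by auto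
    hence "S \<union> {v} = S" using max S v unfolding maximal_def by blast
    with vS show False by auto
  qed
qed

text \<open>
  The rank is defined through columns, while the counting argument is about rows, so full rank is
  translated into independence of the rows. The link between the two is a square matrix B whose
  columns are a maximal independent set of columns of A, filled up with zero columns. The rank is
  full iff no filling is necessary, that is, iff det B is nonzero; and a vector is orthogonal to
  all columns of A iff it is in the kernel of the transpose of B, since the chosen columns span
  the others.
\<close>

lemma (in vec_space) rank_eq_dim_iff:
  assumes A: "A \<in> carrier_mat n nc"
  shows "rank A = n \<longleftrightarrow> (\<forall>c \<in> carrier_vec n. (\<forall>j<nc. col A j \<bullet> c = 0) \<longrightarrow> c = 0\<^sub>v n)"
proof -
  have cs: "set (cols A) \<subseteq> carrier_vec n" using A cols_dim by blast
  obtain S where max: "maximal S (\<lambda>T. T \<subseteq> set (cols A) \<and> lin_indpt T)"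
    using maximal_exists_superset[of "set (cols A)" "\<lambda>T. T \<subseteq> set (cols A) \<and> lin_indpt T" "{}"]
    by (auto simp: lindep_span)
  have S: "S \<subseteq> set (cols A)" "lin_indpt S" using max by (auto simp: maximal_def)
  have Sc: "S \<subseteq> carrier_vec n" using S cs by auto
  have rank: "rank A = card S" by (rule rank_card_indpt[OF A max])
  have "finite S" using S finite_subset by blast
  then obtain ss where ss: "set ss = S" "distinct ss" using finite_distinct_list by blast
  have len: "length ss = card S" using ss distinct_card by metis
  have le: "card S \<le> n" using Sc S(2) by (metis dim_is_n fin_dim li_le_dim(2))
  define B where "B = mat_of_cols n (ss @ replicate (n - card S) (0\<^sub>v n))"
  have B: "B \<in> carrier_mat n n" using le len unfolding B_def by auto
  have colB: "col B j = (if j < card S then ss ! j else 0\<^sub>v n)" if "j < n" for j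
    using that le len Sc ss(1) unfolding B_def
    by (subst col_mat_of_cols) (auto simp: nth_append)
  have det: "det B \<noteq> 0 \<longleftrightarrow> card S = n"
  proof
    assume eq: "card S = n"
    hence "cols B = ss" using ss Sc len unfolding B_def by (simp)
    hence "rank B = n" using lin_indpt_full_rank[OF B] ss S(2) by simp
    thus "det B \<noteq> 0" using det_rank_iff[OF B] by simp
  next
    assume d: "det B \<noteq> 0"
    show "card S = n"
    proof (rule ccontr)
      assume "card S \<noteq> n"
      hence lt: "card S < n" using le by simp
      have "B *\<^sub>v unit_vec n (card S) = col B (card S)"
        using B lt by (intro eq_vecI) auto
      also have "\<dots> = 0\<^sub>v n" using colB[OF lt] by simp
      finally have "B *\<^sub>v unit_vec n (card S) = 0\<^sub>v n" .
      moreover have "unit_vec n (card S) \<noteq> (0\<^sub>v n :: 'a vec)" using lt by simp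
      ultimately show False
        using d det_0_iff_vec_prod_zero_field[OF B] unit_vec_carrier[of n "card S"] by blast
    qed
  qed
  have orth: "(\<forall>j<nc. col A j \<bullet> c = 0) \<longleftrightarrow> transpose_mat B *\<^sub>v c = 0\<^sub>v n"
    if c: "c \<in> carrier_vec n" for c
  proof -
    have "(\<forall>j<nc. col A j \<bullet> c = 0) \<longleftrightarrow> (\<forall>v\<in>set (cols A). v \<bullet> c = 0)"
      using A by (auto simp: cols_def)
    also have "\<dots> \<longleftrightarrow> (\<forall>v\<in>S. v \<bullet> c = 0)"
      using S span_maximal_indpt_cols[OF A max] scalar_prod_span_zero[OF Sc c] by blast
    also have "\<dots> \<longleftrightarrow> (\<forall>j<card S. ss ! j \<bullet> c = 0)"
      using ss(1) len by (metis in_set_conv_nth)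
    also have "\<dots> \<longleftrightarrow> (\<forall>j<n. col B j \<bullet> c = 0)"
    proof (intro iffI allI impI)
      fix j assume *: "\<forall>j<card S. ss ! j \<bullet> c = 0" and j: "j < n"
      show "col B j \<bullet> c = 0" using * c by (simp add: colB[OF j])
    next
      fix j assume *: "\<forall>j<n. col B j \<bullet> c = 0" and j: "j < card S"
      from j le have "j < n" by simp
      with * j show "ss ! j \<bullet> c = 0" using colB[of j] by auto
    qed
    also have "\<dots> \<longleftrightarrow> transpose_mat B *\<^sub>v c = 0\<^sub>v n"
      using B by (auto simp: vec_eq_iff)
    finally show ?thesis .
  qed
  have "rank A = n \<longleftrightarrow> det (transpose_mat B) \<noteq> 0"
    using rank det det_transpose[OF B] by simp
  also have "\<dots> \<longleftrightarrow> (\<forall>c \<in> carrier_vec n. transpose_mat B *\<^sub>v c = 0\<^sub>v n \<longrightarrow> c = 0\<^sub>v n)"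
    using det_0_iff_vec_prod_zero_field[of "transpose_mat B" n] B
    by (metis transpose_carrier_mat)
  finally show ?thesis using orth by simp
qed

lemma rank_eq_dim_row_iff:
  fixes A :: "'a::field mat"
  assumes A: "A \<in> carrier_mat k n"
  shows "vec_space.rank k A = k \<longleftrightarrow>
           (\<forall>c \<in> carrier_vec k. transpose_mat A *\<^sub>v c = 0\<^sub>v n \<longrightarrow> c = 0\<^sub>v k)"
  using vec_space.rank_eq_dim_iff[OF A] A by (auto simp: vec_eq_iff)

section \<open>Counting vectors over a finite field\<close>

text \<open>
  Choosing u with w \<bullet> u = 1 splits the whole space as the hyperplane orthogonal to w plus the line
  through u.
\<close>

lemma card_hyperplane:
  fixes w :: "'a::{field,finite} vec"
  assumes w: "w \<in> carrier_vec k" "w \<noteq> 0\<^sub>v k"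
  shows "CARD('a) * card {c \<in> carrier_vec k. w \<bullet> c = 0} = CARD('a) ^ k"
proof -
  obtain i where i: "i < k" "w $ i \<noteq> 0" using w by (auto simp: vec_eq_iff)
  define u where "u = (1 / w $ i) \<cdot>\<^sub>v unit_vec k i"
  have u: "u \<in> carrier_vec k" by (simp add: u_def)
  have wu: "w \<bullet> u = 1" using w i by (simp add: u_def)
  have "bij_betw (\<lambda>(c, t). c + t \<cdot>\<^sub>v u) ({c \<in> carrier_vec k. w \<bullet> c = 0} \<times> UNIV) (carrier_vec k)"
  proof (rule bij_betw_byWitness[where f' = "\<lambda>c. (c - (w \<bullet> c) \<cdot>\<^sub>v u, w \<bullet> c)"])
    show "\<forall>p\<in>{c \<in> carrier_vec k. w \<bullet> c = 0} \<times> UNIV.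
            (\<lambda>c. (c - (w \<bullet> c) \<cdot>\<^sub>v u, w \<bullet> c)) ((\<lambda>(c, t). c + t \<cdot>\<^sub>v u) p) = p"
      using w u wu by (auto simp: scalar_prod_add_distrib[where n = k])
    show "\<forall>c\<in>carrier_vec k. (\<lambda>(c, t). c + t \<cdot>\<^sub>v u) (c - (w \<bullet> c) \<cdot>\<^sub>v u, w \<bullet> c) = c"
      using u by auto
    show "(\<lambda>c. (c - (w \<bullet> c) \<cdot>\<^sub>v u, w \<bullet> c)) ` carrier_vec k \<subseteq> {c \<in> carrier_vec k. w \<bullet> c = 0} \<times> UNIV"
      using w u wu by (auto simp: scalar_prod_minus_distrib[where n = k])
  qed (use u in auto)
  from bij_betw_same_card[OF this] show ?thesis
    by (simp add: card_cartesian_product card_carrier_vec mult.commute)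
qed

lemma finite_carrier_vec: "finite (carrier_vec n :: 'a::finite vec set)"
  by (rule card_ge_0_finite) (simp add: card_carrier_vec)

lemma finite_carrier_mat: "finite (carrier_mat k n :: 'a::finite mat set)"
proof -
  have "carrier_mat k n \<subseteq> (\<lambda>r. mat_of_rows n r) ` {r :: 'a vec list. set r \<subseteq> carrier_vec n \<and> length r = k}"
  proof
    fix A :: "'a mat" assume A: "A \<in> carrier_mat k n"
    hence "A = mat_of_rows n (rows A)" "set (rows A) \<subseteq> carrier_vec n" "length (rows A) = k"
      using rows_carrier[of A] by auto
    thus "A \<in> (\<lambda>r. mat_of_rows n r) ` {r. set r \<subseteq> carrier_vec n \<and> length r = k}" by blast
  qed
  thus ?thesis using finite_lists_length_eq[OF finite_carrier_vec] finite_surj by blast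
qed

section \<open>Row vectors outside the row space\<close>

definition row_combinations :: "'a::field mat \<Rightarrow> 'a vec set" where
  "row_combinations A = (\<lambda>c. transpose_mat A *\<^sub>v c) ` carrier_vec (dim_row A)"

lemma transpose_mult_inj:
  fixes A :: "'a::field mat"
  assumes A: "A \<in> carrier_mat k n" and rk: "vec_space.rank k A = k"
  shows "inj_on (\<lambda>c. transpose_mat A *\<^sub>v c) (carrier_vec k)"
proof (rule inj_onI)
  fix c d :: "'a vec"
  assume c: "c \<in> carrier_vec k" and d: "d \<in> carrier_vec k"
    and eq: "transpose_mat A *\<^sub>v c = transpose_mat A *\<^sub>v d"
  have AT: "transpose_mat A \<in> carrier_mat n k" using A by simp
  have "transpose_mat A *\<^sub>v (c - d) = 0\<^sub>v n"
    using mult_minus_distrib_mat_vec[OF AT c d] eq mult_mat_vec_carrier[OF AT d] by simp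
  hence "c - d = 0\<^sub>v k" using rank_eq_dim_row_iff[OF A] rk c d by simp
  thus "c = d" using c d by (auto simp: vec_eq_iff)
qed

text \<open>
  By injectivity, counting row combinations that vanish at position j is counting the coefficient
  vectors that produce them, and those are cut out by the single equation given by column j.
\<close>

lemma card_row_combinations_zero_at:
  fixes A :: "'a::field mat"
  assumes A: "A \<in> carrier_mat k n" and rk: "vec_space.rank k A = k" and j: "j < n"
  shows "card {v \<in> row_combinations A. v $ j = 0} = card {c \<in> carrier_vec k. col A j \<bullet> c = 0}"
proof -
  have "{v \<in> row_combinations A. v $ j = 0} =
          (\<lambda>c. transpose_mat A *\<^sub>v c) ` {c \<in> carrier_vec k. col A j \<bullet> c = 0}"
    using A j by (auto simp: row_combinations_def)
  moreover have "inj_on (\<lambda>c. transpose_mat A *\<^sub>v c) {c \<in> carrier_vec k. col A j \<bullet> c = 0}"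
    by (rule inj_on_subset[OF transpose_mult_inj[OF A rk]]) auto
  ultimately show ?thesis by (simp add: card_image)
qed

lemma card_rows_outside:
  fixes A :: "'a::{field,finite} mat"
  assumes A: "A \<in> carrier_mat k n" and rk: "vec_space.rank k A = k" and j: "j < n"
  shows "card {v \<in> carrier_vec n. v $ j = 0 \<and> v \<notin> row_combinations A}
           + card {c \<in> carrier_vec k. col A j \<bullet> c = 0} = CARD('a) ^ (n - 1)"
proof -
  let ?H = "{v \<in> carrier_vec n. v $ j = (0 :: 'a)}"
  let ?R = "{v \<in> row_combinations A. v $ j = 0}"
  have R: "?R \<subseteq> ?H" using A by (auto simp: row_combinations_def)
  \<comment> \<open>Vanishing at position j is orthogonality to the j-th unit vector.\<close>
  have "?H = {v \<in> carrier_vec n. unit_vec n j \<bullet> v = (0 :: 'a)}" using j by auto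
  hence "CARD('a) * card ?H = CARD('a) ^ n"
    using card_hyperplane[of "unit_vec n j :: 'a vec" n] j by simp
  also have "\<dots> = CARD('a) * CARD('a) ^ (n - 1)" using j by (cases n) auto
  finally have "card ?H = CARD('a) ^ (n - 1)" by simp
  moreover have "card (?H - ?R) + card ?R = card ?H"
    using R finite_subset[OF _ finite_carrier_vec[of n], of ?H]
    by (metis (no_types, lifting) card_Diff_subset card_mono finite_subset le_add_diff_inverse2
        mem_Collect_eq subsetI)
  moreover have "?H - ?R = {v \<in> carrier_vec n. v $ j = 0 \<and> v \<notin> row_combinations A}" by auto
  ultimately show ?thesis using card_row_combinations_zero_at[OF A rk j] by simp
qed

section \<open>Appending a row and inserting a zero column\<close>

lemma index_append_row:
  assumes "A \<in> carrier_mat k n" "v \<in> carrier_vec n" "i < Suc k" "j < n"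
  shows "(A @\<^sub>r mat_of_row v) $$ (i, j) = (if i < k then A $$ (i, j) else v $ j)"
  using assms by (auto simp: append_rows_def)

lemma append_row_carrier:
  assumes "A \<in> carrier_mat k n" "v \<in> carrier_vec n"
  shows "A @\<^sub>r mat_of_row v \<in> carrier_mat (Suc k) n"
  using carrier_append_rows[of A k n "mat_of_row v" 1] assms by auto

lemma transpose_append_row_mult:
  fixes A :: "'a::field mat"
  assumes A: "A \<in> carrier_mat k n" and v: "v \<in> carrier_vec n" and c: "c \<in> carrier_vec (Suc k)"
  shows "transpose_mat (A @\<^sub>r mat_of_row v) *\<^sub>v c = transpose_mat A *\<^sub>v vec_first c k + c $ k \<cdot>\<^sub>v v"
proof (rule eq_vecI)
  note B = append_row_carrier[OF A v]
  show "dim_vec (transpose_mat (A @\<^sub>r mat_of_row v) *\<^sub>v c) =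
          dim_vec (transpose_mat A *\<^sub>v vec_first c k + c $ k \<cdot>\<^sub>v v)"
    using A v B by simp
  fix j assume "j < dim_vec (transpose_mat A *\<^sub>v vec_first c k + c $ k \<cdot>\<^sub>v v)"
  hence j: "j < n" using v by simp
  have "(transpose_mat (A @\<^sub>r mat_of_row v) *\<^sub>v c) $ j
          = (\<Sum>i = 0..<Suc k. (A @\<^sub>r mat_of_row v) $$ (i, j) * c $ i)"
    using j B c by (simp add: scalar_prod_def del: sum.op_ivl_Suc)
  also have "\<dots> = (\<Sum>i = 0..<k. A $$ (i, j) * c $ i) + v $ j * c $ k"
    using index_append_row[OF A v _ j] by simp
  also have "\<dots> = (transpose_mat A *\<^sub>v vec_first c k + c $ k \<cdot>\<^sub>v v) $ j"
    using j A v c by (simp add: scalar_prod_def vec_first_def)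
  finally show "(transpose_mat (A @\<^sub>r mat_of_row v) *\<^sub>v c) $ j = \<dots>" .
qed

text \<open>
  A linear relation among the rows of the extended matrix either gives v coefficient zero, and is a
  relation among the rows of A, or can be solved for v.
\<close>

lemma rank_append_row_iff:
  fixes A :: "'a::field mat"
  assumes A: "A \<in> carrier_mat k n" and v: "v \<in> carrier_vec n"
  shows "vec_space.rank (Suc k) (A @\<^sub>r mat_of_row v) = Suc k \<longleftrightarrow>
           vec_space.rank k A = k \<and> v \<notin> row_combinations A"
    (is "?L \<longleftrightarrow> ?R")
proof -
  note B = append_row_carrier[OF A v]
  have AT: "transpose_mat A \<in> carrier_mat n k" using A by simp
  have *: "?L \<longleftrightarrow> (\<forall>c \<in> carrier_vec (Suc k).
             transpose_mat A *\<^sub>v vec_first c k + c $ k \<cdot>\<^sub>v v = 0\<^sub>v n \<longrightarrow> c = 0\<^sub>v (Suc k))"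
    unfolding rank_eq_dim_row_iff[OF B] using transpose_append_row_mult[OF A v] by auto
  \<comment> \<open>Coefficient vectors for the extended matrix: t is the coefficient of the new row v.\<close>
  define ext where "ext c t = vec (Suc k) (\<lambda>i. if i < k then c $ i else t)" for c :: "'a vec" and t
  have ext: "ext c t \<in> carrier_vec (Suc k)" "ext c t $ k = t" for c t
    by (auto simp: ext_def)
  have first: "vec_first (ext c t) k = c" if "c \<in> carrier_vec k" for c t
    using that by (auto simp: ext_def vec_first_def)
  show ?thesis
  proof
    assume L: ?L
    have "c = 0\<^sub>v k" if c: "c \<in> carrier_vec k" and 0: "transpose_mat A *\<^sub>v c = 0\<^sub>v n" for c
    proof -
      have "ext c 0 = 0\<^sub>v (Suc k)"
        using bspec[OF iffD1[OF * L] ext(1)[of c 0]] ext(2) first[OF c] 0 v by auto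
      thus ?thesis using first[OF c, of 0] by (auto simp: vec_first_def)
    qed
    moreover have "v \<notin> row_combinations A"
    proof
      assume "v \<in> row_combinations A"
      then obtain c where c: "c \<in> carrier_vec k" "v = transpose_mat A *\<^sub>v c"
        using A by (auto simp: row_combinations_def)
      have "v + (-1) \<cdot>\<^sub>v v = 0\<^sub>v n" using v by (auto simp: vec_eq_iff)
      hence "ext c (-1) = 0\<^sub>v (Suc k)"
        using bspec[OF iffD1[OF * L] ext(1)[of c "-1"]] ext(2) first[OF c(1)] c(2) by auto
      with ext(2)[of c "-1"] show False by simp
    qed
    ultimately show ?R using rank_eq_dim_row_iff[OF A] by blast
  next
    assume R: ?R
    show ?L unfolding *
    proof (intro ballI impI)
      fix c :: "'a vec" assume c: "c \<in> carrier_vec (Suc k)"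
        and 0: "transpose_mat A *\<^sub>v vec_first c k + c $ k \<cdot>\<^sub>v v = 0\<^sub>v n"
      let ?w = "transpose_mat A *\<^sub>v vec_first c k"
      have entry: "?w $ j + c $ k * v $ j = 0" if "j < n" for j
        using arg_cong[OF 0, of "\<lambda>x. x $ j"] that v by simp
      have ck: "c $ k = 0"
      proof (rule ccontr)
        assume nz: "c $ k \<noteq> 0"
        have "v = (- 1 / c $ k) \<cdot>\<^sub>v ?w"
        proof (rule eq_vecI)
          fix j assume "j < dim_vec ((- 1 / c $ k) \<cdot>\<^sub>v ?w)"
          hence j: "j < n" using A by simp
          have "?w $ j = - (c $ k * v $ j)" using entry[OF j] by (simp add: eq_neg_iff_add_eq_0)
          thus "v $ j = ((- 1 / c $ k) \<cdot>\<^sub>v ?w) $ j" using j A nz by simp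
        qed (use v A in simp)
        also have "\<dots> = transpose_mat A *\<^sub>v ((- 1 / c $ k) \<cdot>\<^sub>v vec_first c k)"
          by (rule mult_mat_vec[OF AT, symmetric]) simp
        also have "\<dots> \<in> row_combinations A" using A by (auto simp: row_combinations_def)
        finally show False using R by simp
      qed
      have "?w = 0\<^sub>v n" using entry ck A by (auto simp: vec_eq_iff)
      hence "vec_first c k = 0\<^sub>v k" using R rank_eq_dim_row_iff[OF A] by auto
      hence "c $ i = 0" if "i < k" for i
        using that by (metis index_vec index_zero_vec(1) vec_first_def)
      thus "c = 0\<^sub>v (Suc k)" using c ck by (auto simp: vec_eq_iff less_Suc_eq)
    qed
  qed
qed

definition insert_zero_col :: "nat \<Rightarrow> 'a::zero mat \<Rightarrow> 'a mat" where
  "insert_zero_col p B = mat (dim_row B) (Suc (dim_col B))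
     (\<lambda>(i, j). if j < p then B $$ (i, j) else if j = p then 0 else B $$ (i, j - 1))"

text \<open>A zero column imposes no condition on the vectors of the left kernel.\<close>

lemma rank_insert_zero_col_iff:
  fixes B :: "'a::field mat"
  assumes B: "B \<in> carrier_mat k m" and p: "p \<le> m"
  shows "vec_space.rank k (insert_zero_col p B) = k \<longleftrightarrow> vec_space.rank k B = k"
proof -
  have carr: "insert_zero_col p B \<in> carrier_mat k (Suc m)"
    using B by (simp add: insert_zero_col_def)
  have col: "col (insert_zero_col p B) j =
      (if j < p then col B j else if j = p then 0\<^sub>v k else col B (j - 1))" if "j < Suc m" for j
    using that B p by (auto simp: insert_zero_col_def)
  have "(\<forall>j<Suc m. col (insert_zero_col p B) j \<bullet> c = 0) \<longleftrightarrow> (\<forall>j<m. col B j \<bullet> c = 0)"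
    if c: "c \<in> carrier_vec k" for c
  proof (intro iffI allI impI)
    fix j assume *: "\<forall>j<Suc m. col (insert_zero_col p B) j \<bullet> c = 0" and j: "j < m"
    show "col B j \<bullet> c = 0"
    proof (cases "j < p")
      case True thus ?thesis using spec[OF *, of j] j by (simp add: col)
    next
      case False thus ?thesis using spec[OF *, of "Suc j"] j by (simp add: col)
    qed
  next
    fix j assume *: "\<forall>j<m. col B j \<bullet> c = 0" and j: "j < Suc m"
    show "col (insert_zero_col p B) j \<bullet> c = 0"
      using spec[OF *, of j] spec[OF *, of "j - 1"] j p c by (auto simp: col)
  qed
  thus ?thesis
    unfolding vec_space.rank_eq_dim_iff[OF carr] vec_space.rank_eq_dim_iff[OF B] by auto
qed

section \<open>The recurrence\<close>

lemma zero_diag_full_rank_mats_iff: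
  "A \<in> zero_diag_full_rank_mats F k n \<longleftrightarrow>
     A \<in> carrier_mat k n \<and> vec_space.rank k A = k \<and> (\<forall>i<k. A $$ (i, i) = 0)"
  by (simp add: zero_diag_full_rank_mats_def)

lemma finite_zero_diag_full_rank_mats: "finite (zero_diag_full_rank_mats F k n)"
  by (rule finite_subset[OF _ finite_carrier_mat[of k n]]) (auto simp: zero_diag_full_rank_mats_iff)

text \<open>
  The condition k < n makes position (k, k) an actual entry of the extended matrix, so that the new
  diagonal condition is the one on v.
\<close>

lemma bij_betw_append_row:
  assumes kn: "k < n"
  shows "bij_betw (\<lambda>(A, v). A @\<^sub>r mat_of_row v)
           (SIGMA A : zero_diag_full_rank_mats F k n.
              {v \<in> carrier_vec n. v $ k = 0 \<and> v \<notin> row_combinations A})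
           (zero_diag_full_rank_mats F (Suc k) n)"
    (is "bij_betw ?app ?S ?T")
proof -
  let ?split = "\<lambda>M. (mat k n (\<lambda>p. M $$ p), row M k)"
  have split_app: "?split (?app (A, v)) = (A, v)"
    if "A \<in> carrier_mat k n" "v \<in> carrier_vec n" for A and v :: "'a vec"
  proof -
    have "mat k n (\<lambda>p. (A @\<^sub>r mat_of_row v) $$ p) = A"
      using that index_append_row[OF that] by (intro eq_matI) auto
    moreover have "row (A @\<^sub>r mat_of_row v) k = v"
      using that index_append_row[OF that] append_row_carrier[OF that] by (intro eq_vecI) auto
    ultimately show ?thesis by simp
  qed
  have app_split: "?app (?split M) = M" if M: "M \<in> carrier_mat (Suc k) n" for M :: "'a mat"
  proof -
    have carr: "mat k n (\<lambda>p. M $$ p) \<in> carrier_mat k n" "row M k \<in> carrier_vec n"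
      using M by (auto intro: row_carrier_vec)
    have "mat k n (\<lambda>p. M $$ p) @\<^sub>r mat_of_row (row M k) = M"
    proof (rule eq_matI)
      fix i j assume "i < dim_row M" "j < dim_col M"
      hence ij: "i < Suc k" "j < n" using M by auto
      thus "(mat k n (\<lambda>p. M $$ p) @\<^sub>r mat_of_row (row M k)) $$ (i, j) = M $$ (i, j)"
        using index_append_row[OF carr ij] M by (cases "i = k") auto
    qed (use append_row_carrier[OF carr] M in auto)
    thus ?thesis by simp
  qed
  have app: "?app (A, v) \<in> ?T \<longleftrightarrow> (A, v) \<in> ?S"
    if carr: "A \<in> carrier_mat k n" "v \<in> carrier_vec n" for A and v :: "'a vec"
  proof -
    have "(\<forall>i<Suc k. (A @\<^sub>r mat_of_row v) $$ (i, i) = 0) \<longleftrightarrow> (\<forall>i<k. A $$ (i, i) = 0) \<and> v $ k = 0"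
      using kn index_append_row[OF carr] by (auto simp: less_Suc_eq)
    thus ?thesis
      using carr append_row_carrier[OF carr] rank_append_row_iff[OF carr]
      by (auto simp: zero_diag_full_rank_mats_iff)
  qed
  show ?thesis
  proof (rule bij_betw_byWitness[where f' = ?split])
    show "\<forall>p\<in>?S. ?split (?app p) = p"
      using split_app by (auto simp: zero_diag_full_rank_mats_iff)
    show "\<forall>M\<in>?T. ?app (?split M) = M"
      using app_split by (auto simp: zero_diag_full_rank_mats_iff)
    show "?app ` ?S \<subseteq> ?T"
      using app by (auto simp: zero_diag_full_rank_mats_iff)
    show "?split ` ?T \<subseteq> ?S"
    proof
      fix p assume "p \<in> ?split ` ?T"
      then obtain M where M: "M \<in> ?T" "p = ?split M" by blast
      hence Mc: "M \<in> carrier_mat (Suc k) n" by (simp add: zero_diag_full_rank_mats_iff)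
      have "?app (?split M) \<in> ?T" using app_split[OF Mc] M(1) by simp
      thus "p \<in> ?S"
        using app[of "mat k n (\<lambda>p. M $$ p)" "row M k"] Mc M(2) by (auto intro: row_carrier_vec)
    qed
  qed
qed

text \<open>
  The sum collects, over all A, the vectors vanishing at position k that are excluded because they
  lie in the row space of A. The statement is additive to stay within the natural numbers.
\<close>

lemma num_zero_diag_Suc:
  fixes F :: "'a::{field,finite} itself"
  assumes kn: "k < n"
  shows "num_zero_diag F (Suc k) n
           + (\<Sum>A\<in>zero_diag_full_rank_mats F k n. card {c \<in> carrier_vec k. col A k \<bullet> c = 0})
         = num_zero_diag F k n * CARD('a) ^ (n - 1)"
proof -
  let ?Z = "zero_diag_full_rank_mats F k n"
  let ?E = "\<lambda>A. {v \<in> carrier_vec n. v $ k = 0 \<and> v \<notin> row_combinations A}"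
  have "finite (?E A)" for A :: "'a mat"
    by (rule finite_subset[OF _ finite_carrier_vec[of n]]) auto
  hence "num_zero_diag F (Suc k) n = (\<Sum>A\<in>?Z. card (?E A))"
    unfolding num_zero_diag_def
    using bij_betw_same_card[OF bij_betw_append_row[OF kn, of F]]
    by (simp add: card_SigmaI finite_zero_diag_full_rank_mats)
  hence "num_zero_diag F (Suc k) n + (\<Sum>A\<in>?Z. card {c \<in> carrier_vec k. col A k \<bullet> c = 0})
       = (\<Sum>A\<in>?Z. card (?E A) + card {c \<in> carrier_vec k. col A k \<bullet> c = 0})"
    by (simp add: sum.distrib)
  also have "\<dots> = (\<Sum>A\<in>?Z. CARD('a) ^ (n - 1))"
    by (rule sum.cong) (use card_rows_outside kn in \<open>auto simp: zero_diag_full_rank_mats_iff\<close>)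
  finally show ?thesis by (simp add: num_zero_diag_def)
qed

text \<open>
  The column removed has index k, to the right of all k diagonal positions, so the diagonal
  entries keep their places.
\<close>

lemma card_zero_diag_zero_col:
  fixes F :: "'a::{field,finite} itself"
  assumes km: "k \<le> m"
  shows "card {A \<in> zero_diag_full_rank_mats F k (Suc m). col A k = 0\<^sub>v k} = num_zero_diag F k m"
proof -
  let ?T = "{A \<in> zero_diag_full_rank_mats F k (Suc m). col A k = 0\<^sub>v k}"
  let ?del = "\<lambda>A. mat k m (\<lambda>(i, j). A $$ (i, if j < k then j else Suc j))"
  have ins_del: "insert_zero_col k (?del A) = A"
    if "A \<in> carrier_mat k (Suc m)" "col A k = 0\<^sub>v k" for A :: "'a mat"
  proof (rule eq_matI)
    fix i j assume "i < dim_row A" "j < dim_col A"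
    hence ij: "i < k" "j < Suc m" using that by auto
    have "A $$ (i, k) = 0"
      using arg_cong[OF that(2), of "\<lambda>x. x $ i"] that(1) ij km by simp
    thus "insert_zero_col k (?del A) $$ (i, j) = A $$ (i, j)"
      using ij km by (auto simp: insert_zero_col_def)
  qed (use that in \<open>auto simp: insert_zero_col_def\<close>)
  have diag: "(\<forall>i<k. insert_zero_col k B $$ (i, i) = 0) \<longleftrightarrow> (\<forall>i<k. B $$ (i, i) = 0)"
    if "B \<in> carrier_mat k m" for B :: "'a mat"
    using that km by (auto simp: insert_zero_col_def)
  have ins: "insert_zero_col k B \<in> ?T \<longleftrightarrow> B \<in> zero_diag_full_rank_mats F k m"
    if B: "B \<in> carrier_mat k m" for B
  proof -
    have "col (insert_zero_col k B) k = 0\<^sub>v k"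
      using B km by (auto simp: insert_zero_col_def)
    moreover have "insert_zero_col k B \<in> carrier_mat k (Suc m)"
      using B by (simp add: insert_zero_col_def)
    ultimately show ?thesis
      using B rank_insert_zero_col_iff[OF B km] diag[OF B]
      by (auto simp: zero_diag_full_rank_mats_iff)
  qed
  have "bij_betw (insert_zero_col k) (zero_diag_full_rank_mats F k m) ?T"
  proof (rule bij_betw_byWitness[where f' = ?del])
    show "\<forall>B\<in>zero_diag_full_rank_mats F k m. ?del (insert_zero_col k B) = B"
      by (auto simp: insert_zero_col_def zero_diag_full_rank_mats_iff intro!: eq_matI)
    show "\<forall>A\<in>?T. insert_zero_col k (?del A) = A"
      using ins_del by (auto simp: zero_diag_full_rank_mats_iff)
    show "insert_zero_col k ` zero_diag_full_rank_mats F k m \<subseteq> ?T"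
      by (intro image_subsetI iffD2[OF ins]) (auto simp: zero_diag_full_rank_mats_iff)
    show "?del ` ?T \<subseteq> zero_diag_full_rank_mats F k m"
    proof
      fix B assume "B \<in> ?del ` ?T"
      then obtain A where A: "A \<in> ?T" "B = ?del A" by blast
      hence "insert_zero_col k B \<in> ?T"
        using ins_del[of A] by (auto simp: zero_diag_full_rank_mats_iff)
      thus "B \<in> zero_diag_full_rank_mats F k m" using ins[of B] A(2) by simp
    qed
  qed
  thus ?thesis by (simp add: bij_betw_same_card num_zero_diag_def)
qed

text \<open>
  Every A loses at least q ^ (k - 1) candidate rows, and the matrices with zero column k lose q ^ k, that is,
  an additional q ^ k - q ^ (k - 1).
\<close>

lemma num_zero_diag_recurrence:
  fixes F :: "'a::{field,finite} itself"
  assumes k: "1 \<le> k" "k < n"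
  defines "q \<equiv> of_nat CARD('a) :: rat"
  shows "of_nat (num_zero_diag F (Suc k) n) =
           of_nat (num_zero_diag F k n) * (q ^ (n - 1) - q ^ (k - 1))
             - of_nat (num_zero_diag F k (n - 1)) * (q ^ k - q ^ (k - 1))"
proof -
  let ?Z = "zero_diag_full_rank_mats F k n"
  let ?N = "{A \<in> ?Z. col A k = 0\<^sub>v k}"
  have fin: "finite ?Z" by (rule finite_zero_diag_full_rank_mats)
  have N: "card ?N = num_zero_diag F k (n - 1)"
    using card_zero_diag_zero_col[of k "n - 1" F] k by simp
  have h: "of_nat (card {c \<in> carrier_vec k. col A k \<bullet> c = 0})
             = q ^ (k - 1) + (if col A k = 0\<^sub>v k then q ^ k - q ^ (k - 1) else 0)"
    if A: "A \<in> ?Z" for A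
  proof (cases "col A k = 0\<^sub>v k")
    case True
    hence "{c \<in> carrier_vec k. col A k \<bullet> c = 0} = carrier_vec k" by auto
    thus ?thesis using True by (simp add: card_carrier_vec q_def)
  next
    case False
    have "col A k \<in> carrier_vec k" using A k by (auto simp: zero_diag_full_rank_mats_iff)
    from card_hyperplane[OF this False]
    have "CARD('a) * card {c \<in> carrier_vec k. col A k \<bullet> c = 0} = CARD('a) * CARD('a) ^ (k - 1)"
      using k by (simp flip: power_Suc)
    thus ?thesis using False by (simp add: q_def)
  qed
  have "of_nat (\<Sum>A\<in>?Z. card {c \<in> carrier_vec k. col A k \<bullet> c = 0})
          = (\<Sum>A\<in>?Z. q ^ (k - 1) + (if col A k = 0\<^sub>v k then q ^ k - q ^ (k - 1) else 0))"
    by (simp only: of_nat_sum) (rule sum.cong[OF refl h])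
  also have "\<dots> = of_nat (card ?Z) * q ^ (k - 1) + of_nat (card ?N) * (q ^ k - q ^ (k - 1))"
    using fin by (simp add: sum.distrib sum.If_cases Int_def)
  also have "\<dots> = of_nat (num_zero_diag F k n) * q ^ (k - 1)
                + of_nat (num_zero_diag F k (n - 1)) * (q ^ k - q ^ (k - 1))"
    by (simp only: N num_zero_diag_def)
  finally have lost: "(of_nat (\<Sum>A\<in>?Z. card {c \<in> carrier_vec k. col A k \<bullet> c = 0}) :: rat) = \<dots>" .
  have "of_nat (num_zero_diag F (Suc k) n)
          + of_nat (\<Sum>A\<in>?Z. card {c \<in> carrier_vec k. col A k \<bullet> c = 0})
        = of_nat (num_zero_diag F k n) * q ^ (n - 1)"
    using arg_cong[OF num_zero_diag_Suc[OF k(2), of F], of "of_nat :: nat \<Rightarrow> rat"]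
    by (simp only: of_nat_add of_nat_mult of_nat_power q_def)
  thus ?thesis unfolding lost by (simp add: algebra_simps)
qed

text \<open>
  The only matrix without rows has row space {0}, so a first row is excluded only if it is zero.
\<close>

lemma num_zero_diag_1:
  fixes F :: "'a::{field,finite} itself"
  assumes n: "1 \<le> n"
  shows "num_zero_diag F 1 n + 1 = CARD('a) ^ (n - 1)"
proof -
  have "vec_space.rank 0 (0\<^sub>m 0 n :: 'a mat) = 0"
    using rank_eq_dim_row_iff[of "0\<^sub>m 0 n :: 'a mat" 0 n] by auto
  hence Z: "zero_diag_full_rank_mats F 0 n = {0\<^sub>m 0 n}"
    by (auto simp: zero_diag_full_rank_mats_iff intro!: eq_matI)
  have "col (0\<^sub>m 0 n :: 'a mat) 0 \<bullet> c = 0" if "c \<in> carrier_vec 0" for c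
    using that by (simp add: scalar_prod_def)
  hence "{c \<in> carrier_vec 0. col (0\<^sub>m 0 n :: 'a mat) 0 \<bullet> c = 0} = carrier_vec 0" by auto
  thus ?thesis
    using num_zero_diag_Suc[of 0 n F] n card_carrier_vec[where n = 0 and 'b = 'a]
    by (simp add: Z num_zero_diag_def)
qed

theorem proposition2p1:
  fixes F :: "'a::{field,finite} itself" and q :: nat and f :: "nat \<Rightarrow> nat \<Rightarrow> rat"
  assumes "primepow q" and "CARD('a) = q"
  defines "f \<equiv> \<lambda>k n. of_nat (num_zero_diag F k n)"
  shows "(\<forall>k n. 1 \<le> k \<and> k < n \<longrightarrow>
           f (k + 1) n =
             of_nat q ^ (k - 1) * (of_nat q - 1) * (f k n * q_bracket q (n - k) - f k (n - 1)))
       \<and> (\<forall>n\<ge>1. f 1 n = of_nat q ^ (n - 1) - 1)"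
proof (intro conjI allI impI)
  let ?q = "of_nat q :: rat"
  have q: "?q - 1 \<noteq> 0" using primepow_gt_Suc_0[OF assms(1)] by auto
  fix k n :: nat
  assume kn: "1 \<le> k \<and> k < n"
  have 1: "?q ^ k - ?q ^ (k - 1) = ?q ^ (k - 1) * (?q - 1)"
    using kn by (cases k) (auto simp: algebra_simps)
  have "n - 1 = (k - 1) + (n - k)" using kn by simp
  hence "?q ^ (n - 1) - ?q ^ (k - 1) = ?q ^ (k - 1) * (?q ^ (n - k) - 1)"
    by (simp add: power_add algebra_simps)
  also have "?q ^ (n - k) - 1 = (?q - 1) * q_bracket q (n - k)"
    using q by (simp add: q_bracket_def)
  finally have 2: "?q ^ (n - 1) - ?q ^ (k - 1) = ?q ^ (k - 1) * ((?q - 1) * q_bracket q (n - k))" .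
  show "f (k + 1) n = ?q ^ (k - 1) * (?q - 1) * (f k n * q_bracket q (n - k) - f k (n - 1))"
    using num_zero_diag_recurrence[of k n F] kn unfolding assms(2) f_def 1 2
    by (simp add: algebra_simps)
next
  fix n :: nat assume "1 \<le> n"
  from arg_cong[OF num_zero_diag_1[OF this, of F], of "of_nat :: nat \<Rightarrow> rat"]
  show "f 1 n = of_nat q ^ (n - 1) - 1"
    by (simp add: f_def assms(2))
qed

end
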